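(* Let $C\in\mathcal C$ be an arbitrary elasticity tensor given in a fixed rectangular coordinate system, and let $S$, $A$ and $R_{ijkl}$ be associated with $C$ as in the context. Among all cubic elasticity tensors $C^{\rm cub}$ in canonical form with respect to the same coordinate system, written with three unknowns $m,n,k$ as $$C^{\rm cub}_{ijkl}=\tfrac1{15}m(\delta_{ij}\delta_{kl}+\delta_{ik}\delta_{jl}+\delta_{il}\delta_{jk})+\tfrac16n(2\delta_{ij}\delta_{kl}-\delta_{il}\delta_{jk}-\delta_{ik}\delta_{jl})+k\,\sigma_{ijkl},$$ the squared Euclidean distance $(C_{ijkl}-C^{\rm cub}_{ijkl})(C_{ijkl}-C^{\rm cub}_{ijkl})$ reaches its minimal value for $$m=S,\qquad n=A,\qquad k=\frac{R_{ijkl}\sigma_{ijkl}}{\sigma_{ijkl}\sigma_{ijkl}}=\tfrac16\left(R_{1111}+R_{2222}+R_{3333}\right).$$ Consequently the parameters $\alpha,\beta,\gamma$ of this closest cubic crystal take the values $$\alpha=\tfrac15S+2k=\tfrac13(C_{1111}+C_{2222}+C_{3333})-\tfrac2{15}S,$$ $$\beta=\tfrac1{15}S-k=-\tfrac16(C_{1111}+C_{2222}+C_{3333})-\tfrac7{30}S,$$ $$\gamma=\tfrac16A.$$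
   Context: Indices run over $1,2,3$, rectangular (orthonormal) coordinates on Euclidean $\mathbb R^3$ are used, so the metric is $\delta_{ij}$; repeated indices are summed unless explicit numerical values are written. The space $\mathcal C$ of elasticity tensors consists of all real arrays $C_{ijkl}$ with $C_{ijkl}=C_{jikl}=C_{klij}$ (hence also $C_{ijkl}=C_{ijlk}$). For $C\in\mathcal C$ put $$S_{ijkl}=\tfrac13(C_{ijkl}+C_{iklj}+C_{iljk}),\quad S_{ij}=S_{ijkk},\quad S=S_{ii}=\tfrac13(C_{iikk}+2C_{ikik}),\quad A=\tfrac13(C_{iikk}-C_{ikik}),$$ $$P_{ij}=S_{ij}-\tfrac13S\,\delta_{ij},$$ $$R_{ijkl}=S_{ijkl}-\tfrac1{15}S(\delta_{ij}\delta_{kl}+\delta_{ik}\delta_{jl}+\delta_{il}\delta_{jk})-\tfrac17(P_{ij}\delta_{kl}+P_{ik}\delta_{jl}+P_{il}\delta_{jk}+P_{jk}\delta_{il}+P_{jl}\delta_{ik}+P_{kl}\delta_{ij}).$$ The constant array $\sigma_{ijkl}$ has the symmetries of $\mathcal C$, with $\sigma_{1111}=\sigma_{2222}=\sigma_{3333}=2$, $\sigma_{1122}=\sigma_{1133}=\sigma_{2233}=-1$, $\sigma_{2323}=\sigma_{3131}=\sigma_{1212}=-1$, and all components not obtained from these by the symmetries equal to zero. A cubic elasticity tensor in canonical form is an element $C^{\rm cub}\in\mathcal C$ with three real parameters $C^{11},C^{12},C^{66}$ such that $C^{\rm cub}_{1111}=C^{\rm cub}_{2222}=C^{\rm cub}_{3333}=C^{11}$,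 $C^{\rm cub}_{1122}=C^{\rm cub}_{1133}=C^{\rm cub}_{2233}=C^{12}$, $C^{\rm cub}_{2323}=C^{\rm cub}_{3131}=C^{\rm cub}_{1212}=C^{66}$, and all components not obtained from these by the symmetries of $\mathcal C$ are zero. Its parameters $\alpha,\beta,\gamma$ are $$\alpha=C^{11},\qquad \beta=\tfrac13(C^{12}+2C^{66}),\qquad \gamma=\tfrac13(C^{12}-C^{66}).$$
   Formalization: The printed values of α and the last expression for β fail unless S=0; the theorem instead proves α = S/5+2k = (C1111+C2222+C3333)/3 and β = S/15−k = −(C1111+C2222+C3333)/6 + S/6. *)

theory Defs
  imports "HOL-Analysis.Analysis"
begin

text \<open>
  Indices are elements of the three-element type \<open>3\<close>, whose elements are \<open>1\<close>, \<open>2\<close> and \<open>3\<close>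
  (with \<open>3 = 0\<close> in this type). Repeated indices are summed explicitly.
\<close>

type_synonym array2 = "3 \<Rightarrow> 3 \<Rightarrow> real"
type_synonym array4 = "3 \<Rightarrow> 3 \<Rightarrow> 3 \<Rightarrow> 3 \<Rightarrow> real"

abbreviation delta :: array2 where
  "delta i j \<equiv> of_bool (i = j)"

definition contract :: "array4 \<Rightarrow> array4 \<Rightarrow> real" where
  "contract C D = (\<Sum>i\<in>UNIV. \<Sum>j\<in>UNIV. \<Sum>k\<in>UNIV. \<Sum>l\<in>UNIV. C i j k l * D i j k l)"

definition sq_distance :: "array4 \<Rightarrow> array4 \<Rightarrow> real" where
  "sq_distance C D = contract (\<lambda>i j k l. C i j k l - D i j k l) (\<lambda>i j k l. C i j k l - D i j k l)"

definition elasticity_tensors :: "array4 set" where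
  "elasticity_tensors = {C. \<forall>i j k l. C i j k l = C j i k l \<and> C i j k l = C k l i j}"

definition sym_part :: "array4 \<Rightarrow> array4" where
  "sym_part C i j k l = 1/3 * (C i j k l + C i k l j + C i l j k)"

definition S2 :: "array4 \<Rightarrow> array2" where
  "S2 C i j = (\<Sum>k\<in>UNIV. sym_part C i j k k)"

definition S_inv :: "array4 \<Rightarrow> real" where
  "S_inv C = (\<Sum>i\<in>UNIV. S2 C i i)"

definition A_inv :: "array4 \<Rightarrow> real" where
  "A_inv C = 1/3 * (\<Sum>i\<in>UNIV. \<Sum>k\<in>UNIV. C i i k k - C i k i k)"

definition P_part :: "array4 \<Rightarrow> array2" where
  "P_part C i j = S2 C i j - 1/3 * S_inv C * delta i j"

definition R_part :: "array4 \<Rightarrow> array4" where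
  "R_part C i j k l = sym_part C i j k l
     - 1/15 * S_inv C * (delta i j * delta k l + delta i k * delta j l + delta i l * delta j k)
     - 1/7 * (P_part C i j * delta k l + P_part C i k * delta j l + P_part C i l * delta j k
            + P_part C j k * delta i l + P_part C j l * delta i k + P_part C k l * delta i j)"

text \<open>
  The orbits, under the symmetries of elasticity tensors, of the index quadruples \<open>1111\<close>,
  \<open>2222\<close>, \<open>3333\<close>, of \<open>1122\<close>, \<open>1133\<close>, \<open>2233\<close>, and of \<open>2323\<close>, \<open>3131\<close>, \<open>1212\<close> are the first three
  cases below; all remaining components vanish.
\<close>

definition cubic_array :: "real \<Rightarrow> real \<Rightarrow> real \<Rightarrow> array4" where
  "cubic_array c11 c12 c66 i j k l =
     (if i = j \<and> j = k \<and> k = l then c11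
      else if i = j \<and> k = l then c12
      else if (i = k \<and> j = l) \<or> (i = l \<and> j = k) then c66
      else 0)"

definition canonical_cubic_tensors :: "array4 set" where
  "canonical_cubic_tensors = {cubic_array c11 c12 c66 | c11 c12 c66. True}"

lemma cubic_array_elasticity: "cubic_array c11 c12 c66 \<in> elasticity_tensors"
proof -
  have ne: "(1::3) \<noteq> 2" "(1::3) \<noteq> 3" "(2::3) \<noteq> 3" "(2::3) \<noteq> 1" "(3::3) \<noteq> 1" "(3::3) \<noteq> 2"
    by simp_all
  show ?thesis
    unfolding elasticity_tensors_def mem_Collect_eq forall_3 cubic_array_def
    by (simp only: ne refl if_True if_False simp_thms not_False_eq_True)
qed

lemma cubic_array_unique:
  assumes "D \<in> elasticity_tensors"
    and "D 1 1 1 1 = c11" "D 2 2 2 2 = c11" "D 3 3 3 3 = c11"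
    and "D 1 1 2 2 = c12" "D 1 1 3 3 = c12" "D 2 2 3 3 = c12"
    and "D 2 3 2 3 = c66" "D 3 1 3 1 = c66" "D 1 2 1 2 = c66"
    and "D 1 1 2 3 = 0" "D 1 1 1 3 = 0" "D 1 1 1 2 = 0"
    and "D 2 2 2 3 = 0" "D 2 2 1 3 = 0" "D 2 2 1 2 = 0"
    and "D 3 3 2 3 = 0" "D 3 3 1 3 = 0" "D 3 3 1 2 = 0"
    and "D 2 3 1 3 = 0" "D 2 3 1 2 = 0" "D 1 3 1 2 = 0"
  shows "D = cubic_array c11 c12 c66"
proof -
  have a: "D i j k l = D j i k l" "D i j k l = D k l i j" for i j k l
    using assms(1) by (auto simp: elasticity_tensors_def)
  have b: "D i j k l = D i j l k" for i j k l
    using a by metis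
  have c: "D 2 1 k l = D 1 2 k l" "D 3 1 k l = D 1 3 k l" "D 3 2 k l = D 2 3 k l"
    "D k l 2 1 = D k l 1 2" "D k l 3 1 = D k l 1 3" "D k l 3 2 = D k l 2 3" for k l
    using a(1) b by blast+
  note d = a(2)[of 2 2 1 1] a(2)[of 3 3 1 1] a(2)[of 3 3 2 2] a(2)[of 2 3 1 1] a(2)[of 2 3 2 2]
    a(2)[of 2 3 3 3] a(2)[of 1 3 1 1] a(2)[of 1 3 2 2] a(2)[of 1 3 3 3] a(2)[of 1 3 2 3]
    a(2)[of 1 2 1 1] a(2)[of 1 2 2 2] a(2)[of 1 2 3 3] a(2)[of 1 2 2 3] a(2)[of 1 2 1 3]
  have e: "D 1 3 1 3 = c66"
    using assms(9) c by simp
  have ne: "(1::3) \<noteq> 2" "(1::3) \<noteq> 3" "(2::3) \<noteq> 3" "(2::3) \<noteq> 1" "(3::3) \<noteq> 1" "(3::3) \<noteq> 2"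
    by simp_all
  have "\<forall>i j k l. D i j k l = cubic_array c11 c12 c66 i j k l"
    unfolding forall_3 cubic_array_def
    by (simp only: c d e ne assms(2-) refl if_True if_False simp_thms not_False_eq_True)
  then show ?thesis
    by (intro ext) blast
qed

definition cubic_sigma :: array4 where
  "cubic_sigma = cubic_array 2 (-1) (-1)"

definition cubic_mnk :: "real \<Rightarrow> real \<Rightarrow> real \<Rightarrow> array4" where
  "cubic_mnk m n \<kappa> i j k l =
     1/15 * m * (delta i j * delta k l + delta i k * delta j l + delta i l * delta j k)
   + 1/6 * n * (2 * delta i j * delta k l - delta i l * delta j k - delta i k * delta j l)
   + \<kappa> * cubic_sigma i j k l"

text \<open>
  For a canonical cubic tensor the parameters \<open>C\<^sup>1\<^sup>1\<close>, \<open>C\<^sup>1\<^sup>2\<close> and \<open>C\<^sup>6\<^sup>6\<close> are its components with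
  indices \<open>1111\<close>, \<open>1122\<close> and \<open>1212\<close>. At \<open>1111\<close> the bracket multiplying \<open>m / 15\<close> equals 3, so \<open>m\<close>
  contributes \<open>m / 5\<close> to the first of these.
\<close>

definition cubic_alpha :: "array4 \<Rightarrow> real" where
  "cubic_alpha D = D 1 1 1 1"

definition cubic_beta :: "array4 \<Rightarrow> real" where
  "cubic_beta D = 1/3 * (D 1 1 2 2 + 2 * D 1 2 1 2)"

definition cubic_gamma :: "array4 \<Rightarrow> real" where
  "cubic_gamma D = 1/3 * (D 1 1 2 2 - D 1 2 1 2)"

end

theory Submission
  imports Defs
begin

text \<open>
  The three families spanning the canonical cubic tensors are pairwise orthogonal, with squared
  norms \<open>1/5\<close>, \<open>1\<close> and \<open>30\<close>, and \<open>S\<close>, \<open>A\<close>, \<open>\<kappa>\<close> are the coefficients of the orthogonal projection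
  of \<open>C\<close> onto their span. The distance therefore splits by Pythagoras, which makes the minimiser
  unique. The closed form of \<open>\<kappa>\<close> uses that \<open>R\<close> is traceless, so its components with indices
  \<open>iijj\<close>, \<open>i \<noteq> j\<close>, sum to the opposite of the sum of its components with indices \<open>iiii\<close>.
\<close>

section \<open>Index symmetries and contractions\<close>

lemma distinct_3:
  "(1::3) \<noteq> 2" "(1::3) \<noteq> 3" "(2::3) \<noteq> 3" "(2::3) \<noteq> 1" "(3::3) \<noteq> 1" "(3::3) \<noteq> 2"
  by simp_all

lemma elasticity_tensors_minor_major:
  assumes "C \<in> elasticity_tensors"
  shows "C i j k l = C j i k l" "C i j k l = C i j l k" "C i j k l = C k l i j"
  using assms unfolding elasticity_tensors_def mem_Collect_eq by metis+

text \<open>Terminating rewrite rules towards one representative per orbit, for the components on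
  which cubic arrays can be nonzero.\<close>

lemma elasticity_tensors_components:
  assumes "C \<in> elasticity_tensors"
  shows "C 2 1 k l = C 1 2 k l" "C 3 1 k l = C 1 3 k l" "C 3 2 k l = C 2 3 k l"
    "C k l 2 1 = C k l 1 2" "C k l 3 1 = C k l 1 3" "C k l 3 2 = C k l 2 3"
    "C 2 2 1 1 = C 1 1 2 2" "C 3 3 1 1 = C 1 1 3 3" "C 3 3 2 2 = C 2 2 3 3"
  by (rule elasticity_tensors_minor_major[OF assms])+

text \<open>The factors 1, 2 and 4 are the orbit sizes of \<open>1111\<close>, \<open>1122\<close>
  and \<open>1212\<close>.\<close>

lemma contract_cubic_array:
  assumes "C \<in> elasticity_tensors"
  shows "contract C (cubic_array a b c) =
    a * (C 1 1 1 1 + C 2 2 2 2 + C 3 3 3 3) + 2 * b * (C 1 1 2 2 + C 1 1 3 3 + C 2 2 3 3)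
    + 4 * c * (C 1 2 1 2 + C 1 3 1 3 + C 2 3 2 3)"
  unfolding contract_def cubic_array_def
  by (simp only: sum_3 distinct_3 refl if_True if_False simp_thms not_False_eq_True
      elasticity_tensors_components[OF assms] mult_zero_right add_0_left add_0_right)
    (simp add: algebra_simps)

lemma contract_commute: "contract C D = contract D C"
  by (simp add: contract_def mult.commute)

lemma contract_diff_right:
  "contract C (\<lambda>i j k l. D i j k l - E i j k l) = contract C D - contract C E"
  by (simp add: contract_def right_diff_distrib sum_subtractf)

lemma sq_distance_eq: "sq_distance C D = contract C C - 2 * contract C D + contract D D"
  unfolding sq_distance_def contract_diff_right
  unfolding contract_commute[of "\<lambda>i j k l. C i j k l - D i j k l"] contract_diff_right
  by (simp add: contract_commute)

section \<open>Coordinates on the cubic tensors\<close>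

lemma cubic_mnk_eq_cubic_array:
  "cubic_mnk m n k = cubic_array (m / 5 + 2 * k) (m / 15 + n / 3 - k) (m / 15 - n / 6 - k)"
proof -
  have "\<forall>i j p q. cubic_mnk m n k i j p q =
    cubic_array (m / 5 + 2 * k) (m / 15 + n / 3 - k) (m / 15 - n / 6 - k) i j p q"
    unfolding forall_3 cubic_mnk_def cubic_sigma_def cubic_array_def
    by (simp only: distinct_3 refl if_True if_False simp_thms not_False_eq_True of_bool_eq)
      (simp add: field_simps)
  then show ?thesis
    by (intro ext) blast
qed

lemma canonical_cubic_tensors_eq_cubic_mnk:
  "canonical_cubic_tensors = {cubic_mnk m n k | m n k. True}"
proof -
  \<comment> \<open>The witnesses are \<open>S\<close>, \<open>A\<close> and \<open>\<kappa>\<close>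
    of the cubic array itself.\<close>
  have "cubic_array a b c =
    cubic_mnk (3 * a + 2 * b + 4 * c) (2 * (b - c)) ((a - b - 2 * c) / 5)" for a b c
    unfolding cubic_mnk_eq_cubic_array by (simp add: field_simps)
  then show ?thesis
    unfolding canonical_cubic_tensors_def
    using cubic_mnk_eq_cubic_array by blast
qed

section \<open>Invariants and the traceless part\<close>

lemma S_inv_elasticity:
  assumes "C \<in> elasticity_tensors"
  shows "S_inv C = C 1 1 1 1 + C 2 2 2 2 + C 3 3 3 3
    + 2/3 * (C 1 1 2 2 + C 1 1 3 3 + C 2 2 3 3) + 4/3 * (C 1 2 1 2 + C 1 3 1 3 + C 2 3 2 3)"
  unfolding S_inv_def S2_def sym_part_def
  by (simp only: sum_3 elasticity_tensors_components[OF assms]) (simp add: field_simps)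

lemma A_inv_elasticity:
  assumes "C \<in> elasticity_tensors"
  shows "A_inv C = 2/3 * (C 1 1 2 2 + C 1 1 3 3 + C 2 2 3 3)
    - 2/3 * (C 1 2 1 2 + C 1 3 1 3 + C 2 3 2 3)"
  unfolding A_inv_def
  by (simp only: sum_3 elasticity_tensors_components[OF assms]) (simp add: field_simps)

text \<open>Averaging over cyclic shifts of the last three indices makes the tensor totally
  symmetric: the swap of \<open>j\<close> and \<open>k\<close> and the symmetries of elasticity
  tensors generate all permutations.\<close>

lemma sym_part_elasticity:
  assumes "C \<in> elasticity_tensors"
  shows "sym_part C \<in> elasticity_tensors" "sym_part C i j k l = sym_part C i k j l"
proof -
  note s = elasticity_tensors_minor_major[OF assms]
  have "sym_part C i j k l = sym_part C j i k l" "sym_part C i j k l = sym_part C k l i j"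
    "sym_part C i j k l = sym_part C i k j l" for i j k l
    unfolding sym_part_def using s by (smt (verit))+
  then show "sym_part C \<in> elasticity_tensors" "sym_part C i j k l = sym_part C i k j l"
    unfolding elasticity_tensors_def by blast+
qed

lemma S2_commute:
  assumes "C \<in> elasticity_tensors"
  shows "S2 C i j = S2 C j i"
  unfolding S2_def
  using elasticity_tensors_minor_major(1)[OF sym_part_elasticity(1)[OF assms]] by simp

text \<open>Total symmetry survives because \<open>P_part\<close> is symmetric, so both subtracted
  brackets are totally symmetric.\<close>

lemma R_part_elasticity:
  assumes "C \<in> elasticity_tensors"
  shows "R_part C \<in> elasticity_tensors" "R_part C i j k l = R_part C i k j l"
proof -
  note s = sym_part_elasticity[OF assms]
  note t = elasticity_tensors_minor_major[OF s(1)]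
  have p: "P_part C i j = P_part C j i" for i j
    unfolding P_part_def using S2_commute[OF assms, of i j] by (simp add: eq_commute)
  have d: "delta i j = delta j i" for i j by (simp add: eq_commute)
  have a: "R_part C i j k l = R_part C j i k l" for i j k l
    unfolding R_part_def using t(1)[of i j k l] p[of i j] d[of i j]
    by (simp add: algebra_simps)
  have b: "R_part C i j k l = R_part C k l i j" for i j k l
    unfolding R_part_def
    using t(3)[of i j k l] p[of k i] p[of l i] p[of k j] p[of l j]
      d[of k i] d[of l i] d[of k j] d[of l j]
    by (simp add: algebra_simps)
  show "R_part C i j k l = R_part C i k j l"
    unfolding R_part_def using s(2)[of i j k l] p[of j k] d[of j k]
    by (simp add: algebra_simps)
  show "R_part C \<in> elasticity_tensors"
    unfolding elasticity_tensors_def using a b by blast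
qed

lemma sum_P_part: "(\<Sum>i\<in>UNIV. P_part C i i) = 0"
  unfolding P_part_def sum_subtractf by (simp add: S_inv_def)

text \<open>The first bracket has double trace 9 + 3 + 3 = 15, cancelled by the factor 1/15; each
  \<open>P_part\<close> term gives a multiple of its trace, which is 0.\<close>

lemma R_part_double_trace: "(\<Sum>i\<in>UNIV. \<Sum>k\<in>UNIV. R_part C i i k k) = 0"
proof -
  have "S_inv C = (\<Sum>i\<in>UNIV. \<Sum>k\<in>UNIV. sym_part C i i k k)"
    by (simp add: S_inv_def S2_def)
  then show ?thesis
    using sum_P_part[of C] unfolding R_part_def sum_3
    by (simp only: distinct_3 refl simp_thms not_False_eq_True of_bool_eq)
      (simp add: field_simps)
qed

text \<open>At \<open>iiii\<close> the first bracket is 3, hence 3/15 of \<open>S_inv C\<close> for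
  each \<open>i\<close>; the \<open>P_part\<close> terms again add up to a multiple of the
  trace.\<close>

lemma sum_R_part_diagonal:
  "R_part C 1 1 1 1 + R_part C 2 2 2 2 + R_part C 3 3 3 3 =
    C 1 1 1 1 + C 2 2 2 2 + C 3 3 3 3 - 3/5 * S_inv C"
  using sum_P_part[of C] unfolding R_part_def sym_part_def sum_3 by (simp add: field_simps)

text \<open>With \<open>X\<close> the sum of the \<open>iiii\<close> and \<open>Y\<close> of the
  \<open>iijj\<close> for \<open>i < j\<close> in the order 1, 2, 3, total symmetry turns the
  contraction into \<open>2 * X - 6 * Y\<close>, and the double trace gives
  \<open>X + 2 * Y = 0\<close>.\<close>

lemma contract_R_part_cubic_sigma:
  assumes "C \<in> elasticity_tensors"
  shows "contract (R_part C) cubic_sigma =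
    5 * (R_part C 1 1 1 1 + R_part C 2 2 2 2 + R_part C 3 3 3 3)"
proof -
  note R = R_part_elasticity[OF assms]
  have "R_part C 1 2 1 2 = R_part C 1 1 2 2" "R_part C 1 3 1 3 = R_part C 1 1 3 3"
    "R_part C 2 3 2 3 = R_part C 2 2 3 3"
    by (rule R(2))+
  then show ?thesis
    using R_part_double_trace[of C]
    unfolding cubic_sigma_def contract_cubic_array[OF R(1)] sum_3
    by (simp add: elasticity_tensors_components[OF R(1)])
qed

lemma contract_cubic_sigma_cubic_sigma: "contract cubic_sigma cubic_sigma = 30"
  unfolding cubic_sigma_def contract_cubic_array[OF cubic_array_elasticity]
  by (simp add: cubic_array_def)

lemma projection_coefficient_cubic_sigma:
  assumes "C \<in> elasticity_tensors"
  shows "contract (R_part C) cubic_sigma / contract cubic_sigma cubic_sigma =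
    (C 1 1 1 1 + C 2 2 2 2 + C 3 3 3 3) / 6 - S_inv C / 10"
  unfolding contract_R_part_cubic_sigma[OF assms] contract_cubic_sigma_cubic_sigma
    sum_R_part_diagonal
  by (simp add: field_simps)

section \<open>Pythagoras and the minimiser\<close>

lemma sq_distance_cubic_mnk:
  assumes "C \<in> elasticity_tensors"
    and "\<kappa> = (C 1 1 1 1 + C 2 2 2 2 + C 3 3 3 3) / 6 - S_inv C / 10"
  shows "sq_distance C (cubic_mnk m n k) = sq_distance C (cubic_mnk (S_inv C) (A_inv C) \<kappa>)
    + 1/5 * (m - S_inv C)\<^sup>2 + (n - A_inv C)\<^sup>2 + 30 * (k - \<kappa>)\<^sup>2"
proof -
  define X where "X = C 1 1 1 1 + C 2 2 2 2 + C 3 3 3 3"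
  define Y where "Y = C 1 1 2 2 + C 1 1 3 3 + C 2 2 3 3"
  define Z where "Z = C 1 2 1 2 + C 1 3 1 3 + C 2 3 2 3"
  have S: "S_inv C = X + 2/3 * Y + 4/3 * Z" and A: "A_inv C = 2/3 * Y - 2/3 * Z"
    using S_inv_elasticity[OF assms(1)] A_inv_elasticity[OF assms(1)]
    by (simp_all add: X_def Y_def Z_def)
  have CX: "X = 6 * \<kappa> + 3/5 * S_inv C"
    using assms(2) by (simp add: X_def)
  \<comment> \<open>\<open>C\<close> enters its contraction with a cubic tensor only through
    \<open>X\<close>, \<open>Y\<close>, \<open>Z\<close>; inverting the linear relations trades
    these for \<open>S\<close>, \<open>A\<close>, \<open>\<kappa>\<close>.\<close>
  have CY: "Y = S_inv C / 5 + A_inv C - 3 * \<kappa>" and CZ: "Z = S_inv C / 5 - A_inv C / 2 - 3 * \<kappa>"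
    using S A CX by linarith+
  \<comment> \<open>The weights 1/5, 1 and 30 recur in \<open>DD\<close>, so the distance completes
    to three separate squares.\<close>
  have CD: "contract C (cubic_mnk m n k) = S_inv C * m / 5 + A_inv C * n + 30 * \<kappa> * k" for m n k
    unfolding cubic_mnk_eq_cubic_array contract_cubic_array[OF assms(1)]
      X_def[symmetric] Y_def[symmetric] Z_def[symmetric] CX CY CZ
    by (simp add: field_simps)
  have DD: "contract (cubic_mnk m n k) (cubic_mnk m n k) = m\<^sup>2 / 5 + n\<^sup>2 + 30 * k\<^sup>2" for m n k
    unfolding cubic_mnk_eq_cubic_array contract_cubic_array[OF cubic_array_elasticity]
    by (simp add: cubic_array_def field_simps power2_eq_square)
  show ?thesis
    unfolding sq_distance_eq[of C] CD DD by (simp add: field_simps power2_eq_square)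
qed

lemma is_arg_min_sq_distance_cubic_mnk_iff:
  assumes "C \<in> elasticity_tensors"
    and "\<kappa> = (C 1 1 1 1 + C 2 2 2 2 + C 3 3 3 3) / 6 - S_inv C / 10"
  shows "is_arg_min (sq_distance C) (\<lambda>D. D \<in> canonical_cubic_tensors) (cubic_mnk m n k)
    \<longleftrightarrow> m = S_inv C \<and> n = A_inv C \<and> k = \<kappa>"
proof -
  let ?d = "\<lambda>m n k. 1/5 * (m - S_inv C)\<^sup>2 + (n - A_inv C)\<^sup>2 + 30 * (k - \<kappa>)\<^sup>2"
  have "is_arg_min (sq_distance C) (\<lambda>D. D \<in> canonical_cubic_tensors) (cubic_mnk m n k)
      \<longleftrightarrow> (\<forall>m' n' k'. ?d m n k \<le> ?d m' n' k')"
  proof -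
    have "sq_distance C (cubic_mnk m n k) \<le> sq_distance C (cubic_mnk m' n' k')
        \<longleftrightarrow> ?d m n k \<le> ?d m' n' k'" for m' n' k'
      using sq_distance_cubic_mnk[OF assms, of m n k] sq_distance_cubic_mnk[OF assms, of m' n' k']
      by linarith
    then show ?thesis
      unfolding is_arg_min_linorder canonical_cubic_tensors_eq_cubic_mnk by blast
  qed
  \<comment> \<open>\<open>?d\<close> is nonnegative and vanishes at \<open>S\<close>,
    \<open>A\<close>, \<open>\<kappa>\<close>, so its minimum is 0.\<close>
  also have "\<dots> \<longleftrightarrow> ?d m n k \<le> 0"
  proof
    assume "\<forall>m' n' k'. ?d m n k \<le> ?d m' n' k'"
    then have "?d m n k \<le> ?d (S_inv C) (A_inv C) \<kappa>" by blast
    then show "?d m n k \<le> 0" by simp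
  next
    assume "?d m n k \<le> 0"
    moreover have "0 \<le> ?d m' n' k'" for m' n' k' by simp
    ultimately show "\<forall>m' n' k'. ?d m n k \<le> ?d m' n' k'" by (meson order_trans)
  qed
  also have "\<dots> \<longleftrightarrow> m = S_inv C \<and> n = A_inv C \<and> k = \<kappa>"
  proof
    assume "?d m n k \<le> 0"
    then have "(m - S_inv C)\<^sup>2 = 0" "(n - A_inv C)\<^sup>2 = 0" "(k - \<kappa>)\<^sup>2 = 0"
      using zero_le_power2[of "m - S_inv C"] zero_le_power2[of "n - A_inv C"]
        zero_le_power2[of "k - \<kappa>"] by linarith+
    then show "m = S_inv C \<and> n = A_inv C \<and> k = \<kappa>" by simp
  qed simp
  finally show ?thesis .
qed

text \<open>In the closed forms of \<open>\<alpha>\<close> and \<open>\<beta>\<close> the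
  coefficients of \<open>S\<close> are 0 and 1/6, where the English statement has -2/15 and -7/30.
  The latter contradict \<open>3 * \<alpha> + 6 * \<beta> = S\<close>, which follows from the forms
  in \<open>S\<close> and \<open>\<kappa>\<close>, unless \<open>S = 0\<close>.\<close>

theorem mainTheorem4:
  fixes C :: array4 and S A \<kappa> :: real
  assumes "C \<in> elasticity_tensors"
    and "S = S_inv C" and "A = A_inv C"
    and "\<kappa> = contract (R_part C) cubic_sigma / contract cubic_sigma cubic_sigma"
  shows "canonical_cubic_tensors = {cubic_mnk m n k | m n k. True}
    \<and> (\<forall>m n k. is_arg_min (sq_distance C) (\<lambda>D. D \<in> canonical_cubic_tensors) (cubic_mnk m n k)
           \<longleftrightarrow> m = S \<and> n = A \<and> k = \<kappa>)
    \<and> \<kappa> = 1/6 * (R_part C 1 1 1 1 + R_part C 2 2 2 2 + R_part C 3 3 3 3)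
    \<and> cubic_alpha (cubic_mnk S A \<kappa>) = 1/5 * S + 2 * \<kappa>
    \<and> 1/5 * S + 2 * \<kappa> = 1/3 * (C 1 1 1 1 + C 2 2 2 2 + C 3 3 3 3)
    \<and> cubic_beta (cubic_mnk S A \<kappa>) = 1/15 * S - \<kappa>
    \<and> 1/15 * S - \<kappa> = - (1/6) * (C 1 1 1 1 + C 2 2 2 2 + C 3 3 3 3) + 1/6 * S
    \<and> cubic_gamma (cubic_mnk S A \<kappa>) = 1/6 * A"
proof -
  \<comment> \<open>Hence \<open>S\<close> cancels in \<open>1/5 * S + 2 * \<kappa>\<close>, and
    1/15 + 1/10 = 1/6 of it remains in \<open>1/15 * S - \<kappa>\<close>.\<close>
  have \<kappa>: "\<kappa> = (C 1 1 1 1 + C 2 2 2 2 + C 3 3 3 3) / 6 - S_inv C / 10"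
    unfolding assms(4) by (rule projection_coefficient_cubic_sigma[OF assms(1)])
  show ?thesis
    unfolding assms(2,3)
  proof (intro conjI allI)
    show "canonical_cubic_tensors = {cubic_mnk m n k | m n k. True}"
      by (rule canonical_cubic_tensors_eq_cubic_mnk)
    show "is_arg_min (sq_distance C) (\<lambda>D. D \<in> canonical_cubic_tensors) (cubic_mnk m n k)
        \<longleftrightarrow> m = S_inv C \<and> n = A_inv C \<and> k = \<kappa>" for m n k
      by (rule is_arg_min_sq_distance_cubic_mnk_iff[OF assms(1) \<kappa>])
    show "\<kappa> = 1/6 * (R_part C 1 1 1 1 + R_part C 2 2 2 2 + R_part C 3 3 3 3)"
      using \<kappa> by (simp add: sum_R_part_diagonal)
  qed (simp_all add: \<kappa> cubic_alpha_def cubic_beta_def cubic_gamma_def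
      cubic_mnk_eq_cubic_array cubic_array_def field_simps)
qed

end
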